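(* Let $X$ be a Banach space and let $\{\varphi_t : X\to X \mid t\ge 0\}$ be a bounded semigroup of linear operators such that for each $v\in X$ the function $t\mapsto \varphi_t(v)$ is continuous for $t>0$. Let $X_0=\{x\in X\mid \varphi_t(x)\to 0 \text{ as } t\to\infty\}$ and suppose that $\operatorname{codim} X_0=n<\infty$. Let $Y\subset X$ be an $n$-dimensional subspace such that $X_0\oplus Y=X$, and write $Y_t=\varphi_t(Y)$. Then $Y$ is almost stabilizable; i.e., for each $t<\infty$, $$\sup_{0\le s<t}\angle(Y_T,Y_{T+s})\to 0\quad\text{as } T\to\infty .$$
   Context: A semigroup means $\varphi_t\circ\varphi_q=\varphi_{t+q}$ for all $t,q\ge 0$; it is bounded if there is a constant $C<\infty$ with $\|\varphi_t\|\le C$ for all $t\ge 0$. For subspaces $A,B\subset X$ the angle is $$\angle(A,B)=\min\Bigl\{\sup_{a\in A,\,|a|=1}\rho(a,B),\ \sup_{b\in B,\,|b|=1}\rho(b,A)\Bigr\},$$ where $\rho(v,A)$ denotes the distance from the vector $v$ to the subspace $A$. *)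

theory Defs
  imports "HOL-Analysis.Analysis"
begin

definition operator_semigroup :: "(real \<Rightarrow> 'a::real_normed_vector \<Rightarrow>\<^sub>L 'a) \<Rightarrow> bool" where
  "operator_semigroup \<phi> \<longleftrightarrow> (\<forall>t\<ge>0. \<forall>q\<ge>0. \<phi> t o\<^sub>L \<phi> q = \<phi> (t + q))"
  \<comment> \<open>Only the values at nonnegative times are constrained, and \<open>\<phi> 0\<close> need not be the identity.\<close>

definition bounded_semigroup :: "(real \<Rightarrow> 'a::real_normed_vector \<Rightarrow>\<^sub>L 'a) \<Rightarrow> bool" where
  "bounded_semigroup \<phi> \<longleftrightarrow> operator_semigroup \<phi> \<and> (\<exists>C. \<forall>t\<ge>0. norm (\<phi> t) \<le> C)"

definition vanishing_vectors :: "(real \<Rightarrow> 'a::real_normed_vector \<Rightarrow>\<^sub>L 'a) \<Rightarrow> 'a set" where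
  "vanishing_vectors \<phi> = {x. ((\<lambda>t. blinfun_apply (\<phi> t) x) \<longlongrightarrow> 0) at_top}"

text \<open>
  The finite spanning set is required because \<^const>\<open>dim\<close> is also \<open>0\<close> on infinite-dimensional
  spaces.
\<close>
definition has_dimension :: "'a::real_vector set \<Rightarrow> nat \<Rightarrow> bool" where
  "has_dimension S n \<longleftrightarrow> subspace S \<and> (\<exists>B. finite B \<and> span B = S) \<and> dim S = n"

text \<open>
  The quotient of the whole space by \<open>S\<close> has dimension \<open>n\<close>: there are \<open>n\<close> vectors whose cosets
  modulo \<open>S\<close> form a basis of the quotient (a coset is zero iff its representative lies in \<open>S\<close>).
\<close>
definition has_codimension :: "'a::real_vector set \<Rightarrow> nat \<Rightarrow> bool" where
  "has_codimension S n \<longleftrightarrow> subspace S \<and>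
     (\<exists>B. finite B \<and> card B = n \<and>
        (\<forall>c. (\<Sum>b\<in>B. c b *\<^sub>R b) \<in> S \<longrightarrow> (\<forall>b\<in>B. c b = 0)) \<and>
        (\<forall>x. \<exists>c. x - (\<Sum>b\<in>B. c b *\<^sub>R b) \<in> S))"

definition direct_sum_UNIV :: "'a::real_vector set \<Rightarrow> 'a set \<Rightarrow> bool" where
  "direct_sum_UNIV A B \<longleftrightarrow> subspace A \<and> subspace B \<and> A \<inter> B = {0} \<and>
     (\<forall>x. \<exists>a\<in>A. \<exists>b\<in>B. x = a + b)"

text \<open>
  Suprema are taken in \<^typ>\<open>ennreal\<close>, so that every supremum is genuine and the supremum over the
  empty unit sphere of the zero subspace is \<open>0\<close>.
\<close>
definition subspace_angle :: "'a::real_normed_vector set \<Rightarrow> 'a set \<Rightarrow> ennreal" where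
  "subspace_angle A B =
     min (SUP a\<in>{a\<in>A. norm a = 1}. ennreal (infdist a B))
         (SUP b\<in>{b\<in>B. norm b = 1}. ennreal (infdist b A))"

definition almost_stabilizable ::
    "(real \<Rightarrow> 'a::real_normed_vector \<Rightarrow>\<^sub>L 'a) \<Rightarrow> 'a set \<Rightarrow> bool" where
  "almost_stabilizable \<phi> Y \<longleftrightarrow>
     (\<forall>t::real. ((\<lambda>T. SUP s\<in>{0..<t}.
         subspace_angle (blinfun_apply (\<phi> T) ` Y) (blinfun_apply (\<phi> (T + s)) ` Y)) \<longlongrightarrow> 0) at_top)"

end

theory Submission
  imports Defs
begin

text \<open>
  Write \<open>X\<^sub>0\<close> for the space of vanishing vectors and \<open>C\<close> for a bound of the semigroup.
  The angle is a minimum of two suprema, so it suffices to bound one of them: every unit vector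
  \<open>b = \<phi>\<^bsub>T+s\<^esub> z\<close> of \<open>Y\<^bsub>T+s\<^esub>\<close> has to be close to \<open>Y\<^sub>T\<close>. Split \<open>\<phi>\<^sub>s z = w + y\<close> along
  \<open>X = X\<^sub>0 \<oplus> Y\<close>. Then \<open>b - \<phi>\<^sub>T y = \<phi>\<^sub>T w\<close> tends to \<open>0\<close> as \<open>T \<rightarrow> \<infinity>\<close>, and the point is to make
  this uniform in \<open>s\<close> and \<open>z\<close>.

  An orbit that comes close to \<open>0\<close> once stays close to \<open>0\<close>, so the orbit of a vector outside \<open>X\<^sub>0\<close>
  is bounded away from \<open>0\<close>. By compactness of the unit sphere of \<open>Y\<close> this holds with one constant
  \<open>\<delta> > 0\<close>, i.e. \<open>|\<phi>\<^sub>t y| \<ge> \<delta> |y|\<close> on \<open>Y\<close> (lemma \<open>orbits_bounded_below\<close>). Hence \<open>|z| \<le> 1/\<delta>\<close>.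
  Moreover \<open>\<phi>\<^sub>t y\<close> and \<open>\<phi>\<^sub>t \<phi>\<^sub>s z\<close> have the same asymptotics, so \<open>|y| \<le> C |z| / \<delta>\<close>;
  boundedness of the projection onto \<open>Y\<close> is thus obtained from the dynamics.

  Since continuity at time \<open>0\<close> is not assumed, the vectors \<open>w\<close> need not lie in a compact set, but
  \<open>\<phi>\<^sub>1 w = \<phi>\<^bsub>1+s\<^esub> z - \<phi>\<^sub>1 y\<close> do: the times \<open>1 + s\<close> stay away from \<open>0\<close> and \<open>z\<close>, \<open>y\<close> range over
  balls of the finite-dimensional space \<open>Y\<close>. Finally, a bounded semigroup tends to \<open>0\<close> uniformly on
  compact sets of vanishing vectors (lemma \<open>uniform_decay_on_compact\<close>), and
  \<open>\<phi>\<^sub>T w = \<phi>\<^bsub>T-1\<^esub> (\<phi>\<^sub>1 w)\<close>.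
\<close>

section \<open>Compactness in finite-dimensional subspaces of normed spaces\<close>

lemma closed_if_compact_Int_cball:
  fixes S :: "'a::real_normed_vector set"
  assumes "\<And>R. compact (S \<inter> cball 0 R)"
  shows "closed S"
  unfolding closed_sequential_limits
proof (intro allI impI)
  fix x l assume x: "(\<forall>n. x n \<in> S) \<and> x \<longlonglongrightarrow> l"
  then have "Bseq x" using convergentI convergent_imp_Bseq by blast
  then obtain R where "\<And>n. norm (x n) \<le> R" by (auto simp: Bseq_def)
  with x have "\<And>n. x n \<in> S \<inter> cball 0 R" by simp
  with x assms[of R] have "l \<in> S \<inter> cball 0 R"
    using closed_sequentially compact_imp_closed by blast
  then show "l \<in> S" by simp
qed

text \<open>
  By induction on \<open>B\<close>: a new vector \<open>b\<close> has positive distance \<open>d\<close> from the closed subspace spanned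
  by the old ones, which bounds the coefficient \<open>k\<close> of \<open>b\<close> in a vector of norm at most \<open>R\<close> by
  \<open>R / d\<close>. The ball is therefore contained in the sum of a compact segment and a compact ball of
  the old span.
\<close>
lemma compact_span_cball:
  fixes B :: "'a::real_normed_vector set"
  assumes "finite B"
  shows "compact (span B \<inter> cball 0 R)"
  using assms
proof (induction B arbitrary: R)
  case empty
  have "span {} \<inter> cball (0::'a) R = (if 0 \<le> R then {0} else {})" by auto
  then show ?case by simp
next
  case (insert b B)
  have cl: "closed (span B)" using insert.IH by (rule closed_if_compact_Int_cball)
  show ?case
  proof (cases "b \<in> span B")
    case True
    then show ?thesis using insert.IH by (simp add: span_redundant)
  next
    case False
    define d where "d = infdist b (span B)"
    have d: "d > 0"
      using False cl in_closed_iff_infdist_zero[of "span B" b] infdist_nonneg[of b "span B"]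
      by (metis d_def empty_iff less_eq_real_def span_zero)
    have coeff: "\<bar>k\<bar> * d \<le> norm x" if "x - k *\<^sub>R b \<in> span B" for k x
    proof (cases "k = 0")
      case False
      have "- (1 / k) *\<^sub>R (x - k *\<^sub>R b) \<in> span B" using that by (rule span_scale)
      moreover have "- (1 / k) *\<^sub>R (x - k *\<^sub>R b) = b - (1 / k) *\<^sub>R x"
        using False by (simp add: algebra_simps)
      ultimately have "d \<le> dist b (b - (1 / k) *\<^sub>R x)"
        unfolding d_def by (metis infdist_le)
      also have "\<dots> = norm x / \<bar>k\<bar>" by (simp add: dist_norm)
      finally show ?thesis using False by (simp add: field_simps)
    qed simp
    define K where "K = (\<lambda>k. k *\<^sub>R b) ` cball 0 (R / d)"
    define L where "L = span B \<inter> cball 0 (R + R / d * norm b)"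
    have cK: "compact K" unfolding K_def
      by (intro compact_continuous_image continuous_intros compact_cball)
    have cL: "compact L" unfolding L_def by (rule insert.IH)
    have "span (insert b B) \<inter> cball 0 R \<subseteq> {x + y |x y. x \<in> K \<and> y \<in> L}"
    proof
      fix x assume x: "x \<in> span (insert b B) \<inter> cball 0 R"
      then obtain k where k: "x - k *\<^sub>R b \<in> span B" by (auto simp: span_insert)
      have nx: "norm x \<le> R" using x by simp
      have kb: "\<bar>k\<bar> \<le> R / d" using coeff[OF k] nx d by (simp add: field_simps)
      then have "norm (x - k *\<^sub>R b) \<le> R + R / d * norm b"
        using norm_triangle_ineq4[of x "k *\<^sub>R b"] nx mult_right_mono[OF kb norm_ge_zero[of b]]
        by simp
      then have "x - k *\<^sub>R b \<in> L" "k *\<^sub>R b \<in> K" using k kb by (auto simp: L_def K_def)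
      then show "x \<in> {x + y |x y. x \<in> K \<and> y \<in> L}" by force
    qed
    moreover have "x + y \<in> span (insert b B)" if "x \<in> K" "y \<in> L" for x y
    proof (rule span_add)
      show "x \<in> span (insert b B)" using that(1) by (auto simp: K_def intro: span_scale span_base)
      show "y \<in> span (insert b B)" using that(2) span_mono[of B "insert b B"] by (auto simp: L_def)
    qed
    ultimately have "span (insert b B) \<inter> cball 0 R = {x + y |x y. x \<in> K \<and> y \<in> L} \<inter> cball 0 R"
      by blast
    then show ?thesis
      by (simp only:) (intro compact_Int_closed compact_sums cK cL closed_cball)
  qed
qed

section \<open>Vanishing vectors of a bounded semigroup\<close>

lemma bounded_semigroup_bound:
  assumes "bounded_semigroup \<phi>"
  shows "\<exists>C>0. \<forall>t\<ge>0. \<forall>x. norm (blinfun_apply (\<phi> t) x) \<le> C * norm x"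
proof -
  obtain C where C: "\<And>t. t \<ge> 0 \<Longrightarrow> norm (\<phi> t) \<le> C"
    using assms by (auto simp: bounded_semigroup_def)
  have "norm (blinfun_apply (\<phi> t) x) \<le> max C 1 * norm x" if "t \<ge> 0" for t x
  proof -
    have "norm (\<phi> t) \<le> max C 1" using C[OF that] by simp
    then show ?thesis by (meson mult_right_mono norm_blinfun norm_ge_zero order_trans)
  qed
  then show ?thesis by (intro exI[of _ "max C 1"]) simp
qed

lemma bounded_semigroup_apply:
  assumes "bounded_semigroup \<phi>" "t \<ge> 0" "q \<ge> 0"
  shows "blinfun_apply (\<phi> t) (blinfun_apply (\<phi> q) x) = blinfun_apply (\<phi> (t + q)) x"
  using assms
  by (metis bounded_semigroup_def operator_semigroup_def blinfun_apply_blinfun_compose)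

text \<open>
  A bounded semigroup multiplies norms by at most \<open>C\<close>, so a single visit to the ball of radius
  \<open>\<epsilon> / C\<close> confines the rest of the orbit to the ball of radius \<open>\<epsilon>\<close>.
\<close>
lemma vanishing_vectors_iff_orbit_small:
  assumes "bounded_semigroup \<phi>"
  shows "x \<in> vanishing_vectors \<phi> \<longleftrightarrow> (\<forall>e>0. \<exists>t\<ge>0. norm (blinfun_apply (\<phi> t) x) < e)"
proof
  assume "x \<in> vanishing_vectors \<phi>"
  then have lim: "((\<lambda>t. blinfun_apply (\<phi> t) x) \<longlongrightarrow> 0) at_top"
    by (simp add: vanishing_vectors_def)
  show "\<forall>e>0. \<exists>t\<ge>0. norm (blinfun_apply (\<phi> t) x) < e"
  proof (intro allI impI)
    fix e :: real assume "e > 0"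
    then have "\<forall>\<^sub>F t in at_top. norm (blinfun_apply (\<phi> t) x) < e"
      using tendstoD[OF lim] by simp
    then have "\<forall>\<^sub>F t in at_top. norm (blinfun_apply (\<phi> t) x) < e \<and> t \<ge> 0"
      by (intro eventually_conj eventually_ge_at_top)
    then show "\<exists>t\<ge>0. norm (blinfun_apply (\<phi> t) x) < e"
      using eventually_happens[of _ "at_top::real filter"] by fastforce
  qed
next
  assume small: "\<forall>e>0. \<exists>t\<ge>0. norm (blinfun_apply (\<phi> t) x) < e"
  obtain C where C: "C > 0" "\<And>t x. t \<ge> 0 \<Longrightarrow> norm (blinfun_apply (\<phi> t) x) \<le> C * norm x"
    using bounded_semigroup_bound[OF assms] by blast
  note sg = bounded_semigroup_apply[OF assms]
  have "((\<lambda>t. blinfun_apply (\<phi> t) x) \<longlongrightarrow> 0) at_top"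
  proof (rule tendstoI)
    fix e :: real assume "e > 0"
    then obtain s where s: "s \<ge> 0" "norm (blinfun_apply (\<phi> s) x) < e / C"
      using small C(1) by (meson divide_pos_pos)
    have "norm (blinfun_apply (\<phi> t) x) < e" if "t \<ge> s" for t
    proof -
      have "norm (blinfun_apply (\<phi> t) x) \<le> C * norm (blinfun_apply (\<phi> s) x)"
        using C(2)[of "t - s" "blinfun_apply (\<phi> s) x"] sg[of "t - s" s x] that s by simp
      also have "\<dots> < e" using s(2) C(1) by (simp add: field_simps)
      finally show ?thesis .
    qed
    then show "\<forall>\<^sub>F t in at_top. dist (blinfun_apply (\<phi> t) x) 0 < e"
      by (auto simp: eventually_at_top_linorder)
  qed
  then show "x \<in> vanishing_vectors \<phi>" by (simp add: vanishing_vectors_def)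
qed

lemma closed_vanishing_vectors:
  assumes "bounded_semigroup \<phi>"
  shows "closed (vanishing_vectors \<phi>)"
proof -
  obtain C where C: "C > 0" "\<And>t x. t \<ge> 0 \<Longrightarrow> norm (blinfun_apply (\<phi> t) x) \<le> C * norm x"
    using bounded_semigroup_bound[OF assms] by blast
  have "l \<in> vanishing_vectors \<phi>" if x: "\<And>n::nat. x n \<in> vanishing_vectors \<phi>" "x \<longlonglongrightarrow> l" for x l
    unfolding vanishing_vectors_iff_orbit_small[OF assms]
  proof (intro allI impI)
    fix e :: real assume e: "e > 0"
    then obtain n where n: "norm (x n - l) < e / (2 * C)"
      using LIMSEQ_D[OF x(2), of "e / (2 * C)"] C(1) by auto
    obtain t where t: "t \<ge> 0" "norm (blinfun_apply (\<phi> t) (x n)) < e / 2"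
      using x(1)[of n] e unfolding vanishing_vectors_iff_orbit_small[OF assms]
      by (meson half_gt_zero)
    have "norm (blinfun_apply (\<phi> t) (x n - l)) \<le> C * norm (x n - l)" using C(2) t by blast
    also have "\<dots> < e / 2" using n C(1) by (simp add: field_simps)
    finally have "norm (blinfun_apply (\<phi> t) l) < e"
      using t(2) norm_triangle_ineq4[of "blinfun_apply (\<phi> t) (x n)" "blinfun_apply (\<phi> t) (x n - l)"]
      by (simp add: blinfun.diff_right)
    then show "\<exists>t\<ge>0. norm (blinfun_apply (\<phi> t) l) < e" using t by blast
  qed
  then show ?thesis by (auto simp: closed_sequential_limits)
qed

lemma vanishing_vectors_invariant:
  assumes "bounded_semigroup \<phi>" "x \<in> vanishing_vectors \<phi>" "s \<ge> 0"
  shows "blinfun_apply (\<phi> s) x \<in> vanishing_vectors \<phi>"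
proof -
  note sg = bounded_semigroup_apply[OF assms(1)]
  have "((\<lambda>t. blinfun_apply (\<phi> s) (blinfun_apply (\<phi> t) x)) \<longlongrightarrow> blinfun_apply (\<phi> s) 0) at_top"
    using assms(2) by (intro tendsto_intros) (simp add: vanishing_vectors_def)
  moreover have "\<forall>\<^sub>F t in at_top. blinfun_apply (\<phi> s) (blinfun_apply (\<phi> t) x)
      = blinfun_apply (\<phi> t) (blinfun_apply (\<phi> s) x)"
    using eventually_ge_at_top[of 0]
    by eventually_elim (use sg assms(3) in \<open>simp add: add.commute\<close>)
  ultimately show ?thesis
    by (simp add: vanishing_vectors_def tendsto_cong)
qed

text \<open>
  Pointwise convergence of an equicontinuous family is uniform on compact sets: control the
  semigroup on a finite net and use the bound \<open>C\<close> between the points of the net.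
\<close>
lemma uniform_decay_on_compact:
  assumes "bounded_semigroup \<phi>" "compact K" "K \<subseteq> vanishing_vectors \<phi>" "e > 0"
  shows "\<forall>\<^sub>F t in at_top. \<forall>x\<in>K. norm (blinfun_apply (\<phi> t) x) < e"
proof -
  obtain C where C: "C > 0" "\<And>t x. t \<ge> 0 \<Longrightarrow> norm (blinfun_apply (\<phi> t) x) \<le> C * norm x"
    using bounded_semigroup_bound[OF assms(1)] by blast
  obtain N where N: "finite N" "N \<subseteq> K" "K \<subseteq> (\<Union>k\<in>N. ball k (e / (2 * C)))"
    using seq_compact_imp_totally_bounded[of K] compact_imp_seq_compact[OF assms(2)] assms(4) C(1)
    by (metis mult_pos_pos divide_pos_pos zero_less_numeral)
  have "\<forall>\<^sub>F t in at_top. norm (blinfun_apply (\<phi> t) k) < e / 2" if "k \<in> N" for k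
  proof -
    have "((\<lambda>t. blinfun_apply (\<phi> t) k) \<longlongrightarrow> 0) at_top"
      using that N(2) assms(3) by (auto simp: vanishing_vectors_def)
    from tendstoD[OF this, of "e / 2"] show ?thesis using assms(4) by simp
  qed
  then have "\<forall>\<^sub>F t in at_top. \<forall>k\<in>N. norm (blinfun_apply (\<phi> t) k) < e / 2"
    using N(1) by (simp add: eventually_ball_finite)
  then show ?thesis using eventually_ge_at_top[of 0]
  proof eventually_elim
    case (elim t)
    show ?case
    proof
      fix x assume "x \<in> K"
      then obtain k where k: "k \<in> N" "norm (k - x) < e / (2 * C)"
        using N(3) by (auto simp: dist_norm)
      have "norm (blinfun_apply (\<phi> t) (k - x)) \<le> C * norm (k - x)" using C(2) elim by blast
      also have "\<dots> < e / 2" using k C(1) by (simp add: field_simps)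
      finally show "norm (blinfun_apply (\<phi> t) x) < e"
        using elim k(1) norm_triangle_ineq4[of "blinfun_apply (\<phi> t) k" "blinfun_apply (\<phi> t) (k - x)"]
        by (fastforce simp: blinfun.diff_right)
    qed
  qed
qed

text \<open>
  If no \<open>\<delta>\<close> works, there are unit vectors \<open>y\<^sub>n\<close> whose orbits come within \<open>1/(n+1)\<close> of \<open>0\<close>. Every limit
  point of \<open>y\<^sub>n\<close> is a unit vector whose orbit comes arbitrarily close to \<open>0\<close>, hence is a vanishing
  vector in \<open>Y\<close>.
\<close>
lemma orbits_bounded_below:
  assumes sg: "bounded_semigroup \<phi>" and Y: "subspace Y" "compact (Y \<inter> cball 0 1)"
    and triv: "vanishing_vectors \<phi> \<inter> Y \<subseteq> {0}"
  obtains \<delta> where "\<delta> > 0" "\<And>t y. t \<ge> 0 \<Longrightarrow> y \<in> Y \<Longrightarrow> \<delta> * norm y \<le> norm (blinfun_apply (\<phi> t) y)"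
proof -
  obtain C where C: "C > 0" "\<And>t x. t \<ge> 0 \<Longrightarrow> norm (blinfun_apply (\<phi> t) x) \<le> C * norm x"
    using bounded_semigroup_bound[OF sg] by blast
  have "\<exists>\<delta>>0. \<forall>t\<ge>0. \<forall>y\<in>Y \<inter> sphere 0 1. \<delta> \<le> norm (blinfun_apply (\<phi> t) y)"
  proof (rule ccontr)
    assume "\<not> ?thesis"
    then have "\<forall>n::nat. \<exists>t y. t \<ge> 0 \<and> y \<in> Y \<inter> sphere 0 1
        \<and> norm (blinfun_apply (\<phi> t) y) < inverse (real (Suc n))"
      by (metis inverse_positive_iff_positive not_le of_nat_0_less_iff zero_less_Suc)
    then obtain t y where ty: "\<And>n. t n \<ge> 0" "\<And>n. y n \<in> Y \<inter> sphere 0 1"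
      "\<And>n. norm (blinfun_apply (\<phi> (t n)) (y n)) < inverse (real (Suc n))"
      by metis
    have "compact ((Y \<inter> cball 0 1) - ball 0 1)"
      using Y(2) open_ball by (rule compact_diff)
    moreover have "(Y \<inter> cball 0 1) - ball 0 1 = Y \<inter> sphere 0 1" by auto
    ultimately have "compact (Y \<inter> sphere 0 1)" by simp
    then obtain l r where l: "l \<in> Y \<inter> sphere 0 1" "strict_mono r" "(y \<circ> r) \<longlonglongrightarrow> l"
      using ty(2) unfolding compact_def by (metis (no_types, lifting))
    have "(\<lambda>n. inverse (real (Suc (r n))) + C * norm (y (r n) - l)) \<longlonglongrightarrow> 0 + C * norm (l - l)"
      using l(3) LIMSEQ_subseq_LIMSEQ[OF LIMSEQ_inverse_real_of_nat l(2)]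
      by (intro tendsto_intros) (auto simp: o_def)
    then have lim: "(\<lambda>n. inverse (real (Suc (r n))) + C * norm (y (r n) - l)) \<longlonglongrightarrow> 0" by simp
    have "l \<in> vanishing_vectors \<phi>"
      unfolding vanishing_vectors_iff_orbit_small[OF sg]
    proof (intro allI impI)
      fix e :: real assume "e > 0"
      then obtain n where n: "inverse (real (Suc (r n))) + C * norm (y (r n) - l) < e"
        using eventually_happens[OF order_tendstoD(2)[OF lim]] by auto
      have "norm (blinfun_apply (\<phi> (t (r n))) l) < e"
        using C(2)[OF ty(1), of "r n" "y (r n) - l"] ty(3)[of "r n"] n
          norm_triangle_ineq4[of "blinfun_apply (\<phi> (t (r n))) (y (r n))"
            "blinfun_apply (\<phi> (t (r n))) (y (r n) - l)"]
        by (simp add: blinfun.diff_right)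
      then show "\<exists>t\<ge>0. norm (blinfun_apply (\<phi> t) l) < e" using ty(1) by blast
    qed
    then show False using l(1) triv by auto
  qed
  then obtain \<delta> where \<delta>: "\<delta> > 0"
    "\<And>t y. t \<ge> 0 \<Longrightarrow> y \<in> Y \<Longrightarrow> norm y = 1 \<Longrightarrow> \<delta> \<le> norm (blinfun_apply (\<phi> t) y)"
    by auto
  have "\<delta> * norm y \<le> norm (blinfun_apply (\<phi> t) y)" if "t \<ge> 0" "y \<in> Y" for t y
  proof (cases "y = 0")
    case False
    have "\<delta> \<le> norm (blinfun_apply (\<phi> t) ((1 / norm y) *\<^sub>R y))"
      using that False Y(1) by (intro \<delta>(2)) (auto simp: subspace_scale)
    then show ?thesis using False by (simp add: blinfun.scaleR_right field_simps)
  qed simp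
  then show thesis using that \<delta>(1) by blast
qed

text \<open>
  The common bound \<open>C\<close> makes the error \<open>\<phi>\<^bsub>t'\<^esub> (x' - x)\<close> of moving the vector small uniformly in the
  time \<open>t'\<close>, so that only the orbit of the fixed vector \<open>x\<close> has to be continuous.
\<close>
lemma jointly_continuous_on_if_strongly_continuous:
  fixes \<phi> :: "'t::topological_space \<Rightarrow> 'a::real_normed_vector \<Rightarrow>\<^sub>L 'b::real_normed_vector"
  assumes bound: "\<And>t x. t \<in> S \<Longrightarrow> norm (blinfun_apply (\<phi> t) x) \<le> C * norm x"
    and cont: "\<And>x. continuous_on S (\<lambda>t. blinfun_apply (\<phi> t) x)"
  shows "continuous_on (S \<times> UNIV) (\<lambda>(t, x). blinfun_apply (\<phi> t) x)"
  unfolding continuous_on_def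
proof (clarsimp)
  fix t and x :: 'a assume t: "t \<in> S"
  let ?F = "at (t, x) within S \<times> UNIV"
  have fst: "((\<lambda>p. fst p) \<longlongrightarrow> t) ?F" and snd: "((\<lambda>p. snd p) \<longlongrightarrow> x) ?F"
    using tendsto_fst[OF tendsto_ident_at, of "(t, x)"] tendsto_snd[OF tendsto_ident_at, of "(t, x)"]
    by simp_all
  have ev: "\<forall>\<^sub>F p in ?F. fst p \<in> S"
    unfolding eventually_at_filter by (rule always_eventually) auto
  have "((\<lambda>p. blinfun_apply (\<phi> (fst p)) x) \<longlongrightarrow> blinfun_apply (\<phi> t) x) ?F"
    using continuous_on_tendsto_compose[OF cont fst t ev] .
  moreover have "((\<lambda>p. blinfun_apply (\<phi> (fst p)) (snd p - x)) \<longlongrightarrow> 0) ?F"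
  proof (rule Lim_null_comparison)
    show "\<forall>\<^sub>F p in ?F. norm (blinfun_apply (\<phi> (fst p)) (snd p - x)) \<le> C * norm (snd p - x)"
      using ev by eventually_elim (rule bound)
    have "((\<lambda>p. C * norm (snd p - x)) \<longlongrightarrow> C * norm (x - x)) ?F"
      using snd by (intro tendsto_intros)
    then show "((\<lambda>p. C * norm (snd p - x)) \<longlongrightarrow> 0) ?F" by simp
  qed
  ultimately have "((\<lambda>p. blinfun_apply (\<phi> (fst p)) x + blinfun_apply (\<phi> (fst p)) (snd p - x))
      \<longlongrightarrow> blinfun_apply (\<phi> t) x + 0) ?F"
    by (rule tendsto_add)
  then show "((\<lambda>(t, x). blinfun_apply (\<phi> t) x) \<longlongrightarrow> blinfun_apply (\<phi> t) x) ?F"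
    by (simp add: blinfun.diff_right case_prod_unfold)
qed

section \<open>Almost stabilization\<close>

lemma tendsto_0_ennrealI:
  fixes f :: "'b \<Rightarrow> ennreal"
  assumes "\<And>e. e > 0 \<Longrightarrow> \<forall>\<^sub>F x in F. f x \<le> ennreal e"
  shows "(f \<longlongrightarrow> 0) F"
proof (rule order_tendstoI)
  fix a :: ennreal assume "0 < a"
  then obtain b where b: "0 < b" "b < a" using dense by blast
  then obtain e where "b = ennreal e" "e > 0"
    by (cases b) (auto simp: ennreal_less_zero_iff)
  with assms[of e] b show "\<forall>\<^sub>F x in F. f x < a"
    by (auto elim: eventually_mono)
qed simp

lemma subspace_angle_le:
  assumes "\<And>b. b \<in> B \<Longrightarrow> norm b = 1 \<Longrightarrow> \<exists>a\<in>A. norm (b - a) \<le> e"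
  shows "subspace_angle A B \<le> ennreal e"
proof -
  have "infdist b A \<le> e" if "b \<in> B" "norm b = 1" for b
    using assms[OF that] infdist_le[of _ A b] by (fastforce simp: dist_norm)
  then have "(SUP b\<in>{b\<in>B. norm b = 1}. ennreal (infdist b A)) \<le> ennreal e"
    by (auto intro!: SUP_least ennreal_leI)
  then show ?thesis unfolding subspace_angle_def by (simp add: min.coboundedI2)
qed

theorem theorem2:
  fixes \<phi> :: "real \<Rightarrow> 'a::banach \<Rightarrow>\<^sub>L 'a" and Y :: "'a set" and n :: nat
  assumes "bounded_semigroup \<phi>"
    and "\<And>v. continuous_on {0<..} (\<lambda>t. blinfun_apply (\<phi> t) v)"
    and "has_codimension (vanishing_vectors \<phi>) n"
    and "has_dimension Y n"
    and "direct_sum_UNIV (vanishing_vectors \<phi>) Y"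
  shows "almost_stabilizable \<phi> Y"
  unfolding almost_stabilizable_def
proof (intro allI tendsto_0_ennrealI)
  fix t e :: real assume e: "e > 0"
  let ?X0 = "vanishing_vectors \<phi>"
  obtain C where C: "C > 0" "\<And>t x. t \<ge> 0 \<Longrightarrow> norm (blinfun_apply (\<phi> t) x) \<le> C * norm x"
    using bounded_semigroup_bound[OF assms(1)] by blast
  note sg = bounded_semigroup_apply[OF assms(1)]
  have Y: "subspace Y" and cY: "\<And>R. compact (Y \<inter> cball 0 R)"
    using assms(4) compact_span_cball by (auto simp: has_dimension_def)
  obtain \<delta> where \<delta>: "\<delta> > 0"
    "\<And>t y. t \<ge> 0 \<Longrightarrow> y \<in> Y \<Longrightarrow> \<delta> * norm y \<le> norm (blinfun_apply (\<phi> t) y)"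
    using orbits_bounded_below[OF assms(1) Y cY] assms(5) by (auto simp: direct_sum_UNIV_def)

  \<comment> \<open>The orbits of \<open>x\<close> and of its component \<open>y\<close> are asymptotic: the first is at most \<open>C |x|\<close>, the
    second at least \<open>\<delta> |y|\<close>.\<close>
  have component_bound: "\<delta> * norm y \<le> C * norm x" if "y \<in> Y" "x - y \<in> ?X0" for x y
  proof (rule field_le_epsilon)
    fix d :: real assume "d > 0"
    then obtain r where r: "r \<ge> 0" "norm (blinfun_apply (\<phi> r) (x - y)) < d"
      using \<open>x - y \<in> ?X0\<close> unfolding vanishing_vectors_iff_orbit_small[OF assms(1)] by blast
    show "\<delta> * norm y \<le> C * norm x + d"
      using r(2) \<delta>(2)[OF r(1) \<open>y \<in> Y\<close>] C(2)[OF r(1), of x]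
        norm_triangle_ineq4[of "blinfun_apply (\<phi> r) x" "blinfun_apply (\<phi> r) (x - y)"]
      by (simp add: blinfun.diff_right)
  qed

  define R where "R = 1 / \<delta>"
  define R' where "R' = C * (C * R) / \<delta>"
  \<comment> \<open>Contains \<open>\<phi>\<^sub>1 w\<close> for all vanishing components \<open>w = \<phi>\<^sub>s z - y\<close> that occur below.\<close>
  define K where "K = {u - v |u v. u \<in> (\<lambda>(r, z). blinfun_apply (\<phi> r) z) ` ({1..1 + t} \<times> (Y \<inter> cball 0 R))
    \<and> v \<in> blinfun_apply (\<phi> 1) ` (Y \<inter> cball 0 R')}"
  have "continuous_on ({1..1 + t} \<times> UNIV) (\<lambda>(r, z). blinfun_apply (\<phi> r) z)"
    by (rule jointly_continuous_on_if_strongly_continuous)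
      (auto intro: C(2) continuous_on_subset[OF assms(2)])
  then have "continuous_on ({1..1 + t} \<times> (Y \<inter> cball 0 R)) (\<lambda>(r, z). blinfun_apply (\<phi> r) z)"
    by (rule continuous_on_subset) auto
  then have "compact K" unfolding K_def
    by (intro compact_differences compact_continuous_image compact_Times compact_Icc cY
        continuous_intros)
  then have "compact (K \<inter> ?X0)"
    using closed_vanishing_vectors[OF assms(1)] by (rule compact_Int_closed)
  then have "\<forall>\<^sub>F T in at_top. \<forall>x\<in>K \<inter> ?X0. norm (blinfun_apply (\<phi> T) x) < e"
    by (rule uniform_decay_on_compact[OF assms(1)]) (use e in auto)
  then obtain T0 where T0: "\<And>T x. T \<ge> T0 \<Longrightarrow> x \<in> K \<inter> ?X0 \<Longrightarrow> norm (blinfun_apply (\<phi> T) x) < e"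
    by (auto simp: eventually_at_top_linorder)

  have close: "\<exists>a\<in>blinfun_apply (\<phi> T) ` Y. norm (b - a) \<le> e"
    if T: "T \<ge> max 0 T0 + 1" and s: "s \<in> {0..<t}"
      and b: "b \<in> blinfun_apply (\<phi> (T + s)) ` Y" "norm b = 1" for T s b
  proof -
    obtain z where z: "z \<in> Y" "b = blinfun_apply (\<phi> (T + s)) z" using b(1) by blast
    have "\<delta> * norm z \<le> 1" using \<delta>(2)[of "T + s" z] z b(2) T s by simp
    then have zR: "norm z \<le> R" using \<delta>(1) by (simp add: R_def field_simps)
    obtain w y where wy: "w \<in> ?X0" "y \<in> Y" "blinfun_apply (\<phi> s) z = w + y"
      using assms(5) unfolding direct_sum_UNIV_def by meson
    have "\<delta> * norm y \<le> C * norm (blinfun_apply (\<phi> s) z)"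
      using wy by (intro component_bound) auto
    also have "\<dots> \<le> C * (C * R)"
      using C(1) C(2)[of s z] s zR by (smt (verit) atLeastLessThan_iff mult_left_mono)
    finally have yR: "norm y \<le> R'" using \<delta>(1) by (simp add: R'_def field_simps)
    have "blinfun_apply (\<phi> 1) w = blinfun_apply (\<phi> (1 + s)) z - blinfun_apply (\<phi> 1) y"
      using sg[of 1 s z] s wy(3) by (simp add: blinfun.add_right eq_diff_eq)
    moreover have "blinfun_apply (\<phi> (1 + s)) z
        \<in> (\<lambda>(r, z). blinfun_apply (\<phi> r) z) ` ({1..1 + t} \<times> (Y \<inter> cball 0 R))"
      using s z(1) zR by (intro image_eqI[of _ _ "(1 + s, z)"]) auto
    ultimately have "blinfun_apply (\<phi> 1) w \<in> K"
      unfolding K_def using wy(2) yR by fastforce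
    then have "norm (blinfun_apply (\<phi> (T - 1)) (blinfun_apply (\<phi> 1) w)) < e"
      using vanishing_vectors_invariant[OF assms(1) wy(1)] T by (intro T0) auto
    moreover have "blinfun_apply (\<phi> (T - 1)) (blinfun_apply (\<phi> 1) w) = b - blinfun_apply (\<phi> T) y"
      using sg[of "T - 1" 1 w] sg[of T s z] T s z(2) wy(3)
      by (simp add: blinfun.add_right algebra_simps)
    ultimately show ?thesis using wy(2) by (auto intro!: bexI[of _ y])
  qed
  show "\<forall>\<^sub>F T in at_top. (SUP s\<in>{0..<t}. subspace_angle (blinfun_apply (\<phi> T) ` Y)
      (blinfun_apply (\<phi> (T + s)) ` Y)) \<le> ennreal e"
    using eventually_ge_at_top[of "max 0 T0 + 1"]
    by eventually_elim (intro SUP_least subspace_angle_le close)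
qed

end
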